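(* Let $M\in[0,2)$, let $n\ge 1$, and let $\Phi(\cdot,t_{n-1})$ satisfy $\sum_{\ell=-2}^{2}\|\phi_\ell(\cdot,t_{n-1})\|^2=1$ and $\sum_{\ell=-2}^{2}\ell\,\|\phi_\ell(\cdot,t_{n-1})\|^2=M$. Let $\Phi(\cdot,t)=(\phi_2,\phi_1,\phi_0,\phi_{-1},\phi_{-2})^T$ be the solution on $[t_{n-1},t_n)$, $t_n=t_{n-1}+\Delta t$, of the gradient flow described in the context, starting from $\Phi(\cdot,t_{n-1})$, and put $\phi_\ell(\cdot,t_n^-)=\lim_{t\to t_n^-}\phi_\ell(\cdot,t)$ and $N_\ell:=\|\phi_\ell(\cdot,t_n^-)\|$. Consider the system for the projection constants $\sigma_\ell^n\ge 0$ ($\ell=2,1,0,-1,-2$) $$\sum_{\ell=-2}^{2}(\sigma_\ell^n)^2N_\ell^2=1,\qquad \sum_{\ell=-2}^{2}\ell\,(\sigma_\ell^n)^2N_\ell^2=M,$$ $$\sigma_2^n\sigma_{-2}^n=(\sigma_0^n)^2,\qquad \sigma_1^n\sigma_{-1}^n=(\sigma_0^n)^2,\qquad \sigma_2^n\sigma_0^n=(\sigma_1^n)^2 .$$ Then, for sufficiently small time step size $\Delta t>0$, the solution of this system can be given as follows. (i) When $M=1$, $N_1>0$ and $N_\ell=0$ for $\ell=2,0,-1,-2$: $$\sigma_1^n=\frac1{N_1},\qquad \sigma_0^n=1,\qquad \sigma_\ell^n=(\sigma_1^n)^{\ell},\quad \ell=2,-1,-2.$$ (ii) When $M=0$, $N_0>0$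 and $N_\ell=0$ for $\ell=2,1,-1,-2$: $$\sigma_0^n=\frac1{N_0},\qquad \sigma_1^n=1,\qquad \sigma_\ell^n=(\sigma_0^n)^{1-\ell},\quad \ell=2,-1,-2.$$ (iii) In all other cases: $$\sigma_0^n=\frac{1}{\sqrt{\sum_{\ell=-2}^{2}\lambda_*^{\ell}N_\ell^2}},\qquad \sigma_\ell^n=\sigma_0^n\,\lambda_*^{\ell/2},\quad \ell=2,1,-1,-2,$$ where $\lambda_*$ is the unique positive solution of the algebraic equation in the unknown $\lambda$ $$\sum_{\ell=-2}^{2}(\ell-M)\,N_\ell^2\,\lambda^{\ell+2}=0 .$$
   Context: $\|\cdot\|$ is the $L^2(\mathbb{R}^d)$ norm, $d\in\{1,2,3\}$. $V:\mathbb{R}^d\to\mathbb{R}$ is a given external trapping potential and $\beta_0,\beta_1,\beta_2$ are real constants. For $\Phi=(\phi_2,\phi_1,\phi_0,\phi_{-1},\phi_{-2})^T$ with complex-valued components, set $$\rho=\sum_{\ell=-2}^2|\phi_\ell|^2,\quad H_\rho=-\tfrac12\nabla^2+V+\beta_0\rho,\quad A_{00}=\frac{2\phi_2\phi_{-2}-2\phi_1\phi_{-1}+\phi_0^2}{\sqrt5},$$ $$F_+=2(\bar\phi_2\phi_1+\bar\phi_{-1}\phi_{-2})+\sqrt6(\bar\phi_1\phi_0+\bar\phi_0\phi_{-1}),\quad F_-=\overline{F_+},\quad F_z=2(|\phi_2|^2-|\phi_{-2}|^2)+|\phi_1|^2-|\phi_{-1}|^2 .$$ The gradient flow (without normalization)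 on $[t_{n-1},t_n)$ is $$\partial_t\phi_{\pm2}=-\Big[(H_\rho\pm2\beta_1F_z)\phi_{\pm2}+\beta_1F_{\mp}\phi_{\pm1}+\tfrac{\beta_2}{\sqrt5}A_{00}\bar\phi_{\mp2}\Big],$$ $$\partial_t\phi_{\pm1}=-\Big[(H_\rho\pm\beta_1F_z)\phi_{\pm1}+\beta_1\big(\tfrac{\sqrt6}{2}F_{\mp}\phi_0+F_{\pm}\phi_{\pm2}\big)-\tfrac{\beta_2}{\sqrt5}A_{00}\bar\phi_{\mp1}\Big],$$ $$\partial_t\phi_0=-\Big[H_\rho\phi_0+\tfrac{\sqrt6}{2}\beta_1(F_+\phi_1+F_-\phi_{-1})+\tfrac{\beta_2}{\sqrt5}A_{00}\bar\phi_0\Big].$$ It is the flow step of the "gradient flow with discrete normalization"; it is followed by the projection step $\phi_\ell(\cdot,t_n)=\sigma_\ell^n\phi_\ell(\cdot,t_n^-)$, which is to restore $\sum_\ell\|\phi_\ell(\cdot,t_n)\|^2=1$ and $\sum_\ell\ell\|\phi_\ell(\cdot,t_n)\|^2=M$. The flow is assumed to have a (unique) solution for which $t\mapsto\|\phi_\ell(\cdot,t)\|$ is continuous on $[t_{n-1},t_n)$ and the left limits at $t_n$ exist. "Sufficiently small $\Delta t$" is relative to the given state $\Phi(\cdot,t_{n-1})$. *)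

theory Defs
  imports "HOL-Analysis.Analysis"
begin

text \<open>
  The five components are indexed by the integers \<open>-2..2\<close>. All families below are functions on
  \<^typ>\<open>int\<close>; values at indices outside \<open>{-2..2}\<close> are never used.
\<close>

type_synonym 'd wave = "real ^ 'd \<Rightarrow> complex"
type_synonym 'd spinor = "int \<Rightarrow> 'd wave"

definition in_L2 :: "'d::finite wave \<Rightarrow> bool" where
  "in_L2 f \<longleftrightarrow> f \<in> borel_measurable lborel \<and> integrable lborel (\<lambda>x. (cmod (f x))\<^sup>2)"

definition L2norm :: "'d::finite wave \<Rightarrow> real" where
  "L2norm f = sqrt (LINT x|lborel. (cmod (f x))\<^sup>2)"

definition partial_deriv :: "real ^ 'd \<Rightarrow> 'd::finite wave \<Rightarrow> 'd wave" where
  "partial_deriv b f x = frechet_derivative f (at x) b"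

definition twice_cont_diff :: "'d::finite wave \<Rightarrow> bool" where
  "twice_cont_diff f \<longleftrightarrow>
     (\<forall>x. f differentiable (at x)) \<and>
     (\<forall>b\<in>Basis. (\<forall>x. partial_deriv b f differentiable (at x)) \<and>
        (\<forall>c\<in>Basis. continuous_on UNIV (partial_deriv c (partial_deriv b f))))"

definition laplacian :: "'d::finite wave \<Rightarrow> 'd wave" where
  "laplacian f x = (\<Sum>b\<in>Basis. partial_deriv b (partial_deriv b f) x)"

definition density :: "(int \<Rightarrow> complex) \<Rightarrow> real" where
  "density c = (\<Sum>l\<in>{-2..2}. (cmod (c l))\<^sup>2)"

definition A00 :: "(int \<Rightarrow> complex) \<Rightarrow> complex" where
  "A00 c = (2 * c 2 * c (-2) - 2 * c 1 * c (-1) + (c 0)\<^sup>2) / complex_of_real (sqrt 5)"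

definition F_plus :: "(int \<Rightarrow> complex) \<Rightarrow> complex" where
  "F_plus c = 2 * (cnj (c 2) * c 1 + cnj (c (-1)) * c (-2))
     + complex_of_real (sqrt 6) * (cnj (c 1) * c 0 + cnj (c 0) * c (-1))"

definition F_minus :: "(int \<Rightarrow> complex) \<Rightarrow> complex" where
  "F_minus c = cnj (F_plus c)"

definition F_z :: "(int \<Rightarrow> complex) \<Rightarrow> real" where
  "F_z c = 2 * ((cmod (c 2))\<^sup>2 - (cmod (c (-2)))\<^sup>2) + (cmod (c 1))\<^sup>2 - (cmod (c (-1)))\<^sup>2"

definition H_rho :: "(real ^ 'd \<Rightarrow> real) \<Rightarrow> real \<Rightarrow> 'd::finite spinor \<Rightarrow> 'd wave \<Rightarrow> 'd wave" where
  "H_rho V \<beta>0 \<phi> f x =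
     - (1 / 2) * laplacian f x + complex_of_real (V x + \<beta>0 * density (\<lambda>k. \<phi> k x)) * f x"

text \<open>The bracket in the flow equation for component \<open>l\<close>, so that the flow is
  \<open>\<partial>\<^sub>t \<phi>\<^sub>l = - flow_bracket \<dots> l\<close>.\<close>

definition flow_bracket ::
  "(real ^ 'd \<Rightarrow> real) \<Rightarrow> real \<Rightarrow> real \<Rightarrow> real \<Rightarrow> 'd::finite spinor \<Rightarrow> int \<Rightarrow> 'd wave" where
  "flow_bracket V \<beta>0 \<beta>1 \<beta>2 \<phi> l x =
    (let c = (\<lambda>k. \<phi> k x);
         b1 = complex_of_real \<beta>1;
         b2 = complex_of_real (\<beta>2 / sqrt 5);
         r = complex_of_real (sqrt 6 / 2);
         Fz = complex_of_real (F_z c);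
         H = H_rho V \<beta>0 \<phi> (\<phi> l) x
     in if l = 2 then
          (H + 2 * b1 * Fz * c 2) + b1 * F_minus c * c 1 + b2 * A00 c * cnj (c (-2))
        else if l = -2 then
          (H - 2 * b1 * Fz * c (-2)) + b1 * F_plus c * c (-1) + b2 * A00 c * cnj (c 2)
        else if l = 1 then
          (H + b1 * Fz * c 1) + b1 * (r * F_minus c * c 0 + F_plus c * c 2)
            - b2 * A00 c * cnj (c (-1))
        else if l = -1 then
          (H - b1 * Fz * c (-1)) + b1 * (r * F_plus c * c 0 + F_minus c * c (-2))
            - b2 * A00 c * cnj (c 1)
        else
          H + r * b1 * (F_plus c * c 1 + F_minus c * c (-1)) + b2 * A00 c * cnj (c 0))"

text \<open>Classical solution of the Cauchy problem on \<open>[a, b)\<close> with data \<open>\<Phi>0\<close> at time \<open>a\<close>: jointly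
  continuous up to the initial time, \<open>C\<^sup>2\<close> in space and satisfying the equations for \<open>a < t < b\<close>,
  with values in \<open>L\<^sup>2\<close> and continuous component norms on \<open>[a, b)\<close>. The argument order
  is \<open>\<Phi> t l x\<close>.\<close>

definition flow_solution ::
  "(real ^ 'd \<Rightarrow> real) \<Rightarrow> real \<Rightarrow> real \<Rightarrow> real \<Rightarrow> real \<Rightarrow> real \<Rightarrow> 'd::finite spinor
     \<Rightarrow> (real \<Rightarrow> 'd spinor) \<Rightarrow> bool" where
  "flow_solution V \<beta>0 \<beta>1 \<beta>2 a b \<Phi>0 \<Phi> \<longleftrightarrow>
     (\<forall>l\<in>{-2..2}.
        \<Phi> a l = \<Phi>0 l \<and>
        continuous_on ({a..<b} \<times> UNIV) (\<lambda>(t, x). \<Phi> t l x) \<and>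
        (\<forall>t\<in>{a..<b}. in_L2 (\<Phi> t l)) \<and>
        continuous_on {a..<b} (\<lambda>t. L2norm (\<Phi> t l)) \<and>
        (\<forall>t\<in>{a<..<b}. twice_cont_diff (\<Phi> t l) \<and>
           (\<forall>x. ((\<lambda>s. \<Phi> s l x) has_vector_derivative
                   - flow_bracket V \<beta>0 \<beta>1 \<beta>2 (\<Phi> t) l x) (at t))))"

text \<open>The left limit \<open>\<phi>\<^sub>l(\<cdot>, b\<^sup>-)\<close> is taken in \<open>L\<^sup>2\<close>.\<close>

definition left_limit :: "(real \<Rightarrow> 'd::finite spinor) \<Rightarrow> real \<Rightarrow> 'd spinor \<Rightarrow> bool" where
  "left_limit \<Phi> b \<Phi>m \<longleftrightarrow>
     (\<forall>l\<in>{-2..2}. in_L2 (\<Phi>m l) \<and>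
        ((\<lambda>t. L2norm (\<lambda>x. \<Phi> t l x - \<Phi>m l x)) \<longlongrightarrow> 0) (at_left b))"

definition unique_flow ::
  "(real ^ 'd \<Rightarrow> real) \<Rightarrow> real \<Rightarrow> real \<Rightarrow> real \<Rightarrow> real \<Rightarrow> real \<Rightarrow> 'd::finite spinor \<Rightarrow> bool" where
  "unique_flow V \<beta>0 \<beta>1 \<beta>2 a b \<Phi>0 \<longleftrightarrow>
     (\<exists>\<Phi>. flow_solution V \<beta>0 \<beta>1 \<beta>2 a b \<Phi>0 \<Phi> \<and> (\<exists>\<Phi>m. left_limit \<Phi> b \<Phi>m) \<and>
        (\<forall>\<Psi>. flow_solution V \<beta>0 \<beta>1 \<beta>2 a b \<Phi>0 \<Psi> \<longrightarrow>
           (\<forall>t\<in>{a..<b}. \<forall>l\<in>{-2..2}. \<forall>x. \<Psi> t l x = \<Phi> t l x)))"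

definition projection_system :: "real \<Rightarrow> (int \<Rightarrow> real) \<Rightarrow> (int \<Rightarrow> real) \<Rightarrow> bool" where
  "projection_system M N \<sigma> \<longleftrightarrow>
     (\<forall>l\<in>{-2..2}. \<sigma> l \<ge> 0) \<and>
     (\<Sum>l\<in>{-2..2}. (\<sigma> l)\<^sup>2 * (N l)\<^sup>2) = 1 \<and>
     (\<Sum>l\<in>{-2..2}. real_of_int l * (\<sigma> l)\<^sup>2 * (N l)\<^sup>2) = M \<and>
     \<sigma> 2 * \<sigma> (-2) = (\<sigma> 0)\<^sup>2 \<and>
     \<sigma> 1 * \<sigma> (-1) = (\<sigma> 0)\<^sup>2 \<and>
     \<sigma> 2 * \<sigma> 0 = (\<sigma> 1)\<^sup>2"

definition lambda_equation :: "real \<Rightarrow> (int \<Rightarrow> real) \<Rightarrow> real \<Rightarrow> bool" where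
  "lambda_equation M N lam \<longleftrightarrow>
     (\<Sum>l\<in>{-2..2}. (real_of_int l - M) * (N l)\<^sup>2 * lam powi (l + 2)) = 0"

definition case_i :: "real \<Rightarrow> (int \<Rightarrow> real) \<Rightarrow> bool" where
  "case_i M N \<longleftrightarrow> M = 1 \<and> N 1 > 0 \<and> (\<forall>l\<in>{2, 0, -1, -2}. N l = 0)"

definition case_ii :: "real \<Rightarrow> (int \<Rightarrow> real) \<Rightarrow> bool" where
  "case_ii M N \<longleftrightarrow> M = 0 \<and> N 0 > 0 \<and> (\<forall>l\<in>{2, 1, -1, -2}. N l = 0)"

definition formula_i :: "(int \<Rightarrow> real) \<Rightarrow> (int \<Rightarrow> real) \<Rightarrow> bool" where
  "formula_i N \<sigma> \<longleftrightarrow>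
     \<sigma> 1 = 1 / N 1 \<and> \<sigma> 0 = 1 \<and> (\<forall>l\<in>{2, -1, -2}. \<sigma> l = \<sigma> 1 powi l)"

definition formula_ii :: "(int \<Rightarrow> real) \<Rightarrow> (int \<Rightarrow> real) \<Rightarrow> bool" where
  "formula_ii N \<sigma> \<longleftrightarrow>
     \<sigma> 0 = 1 / N 0 \<and> \<sigma> 1 = 1 \<and> (\<forall>l\<in>{2, -1, -2}. \<sigma> l = \<sigma> 0 powi (1 - l))"

definition formula_iii :: "(int \<Rightarrow> real) \<Rightarrow> real \<Rightarrow> (int \<Rightarrow> real) \<Rightarrow> bool" where
  "formula_iii N lam \<sigma> \<longleftrightarrow>
     \<sigma> 0 = 1 / sqrt (\<Sum>l\<in>{-2..2}. lam powi l * (N l)\<^sup>2) \<and>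
     (\<forall>l\<in>{2, 1, -1, -2}. \<sigma> l = \<sigma> 0 * lam powr (real_of_int l / 2))"

end

theory Submission
  imports Defs
begin

text \<open>
  Write \<open>n\<^sub>l\<close> for the component norms of the initial state. The mass and magnetization constraints say
  that the numbers \<open>n\<^sub>l\<^sup>2\<close> are a probability distribution on \<open>{-2..2}\<close> with mean \<open>M\<close>. Hence either it
  charges an index below \<open>M\<close> and an index above \<open>M\<close>, or it is concentrated at the single index \<open>m = M\<close>,
  and then \<open>m\<close> is \<open>0\<close> or \<open>1\<close> because \<open>0 \<le> M < 2\<close> (\<open>mean_dichotomy\<close>).

  Uniqueness of the flow makes the solutions for different step sizes restrictions of one solution, and
  the norm of the left limit is the norm of that solution (\<open>left_limit_L2norm\<close>). So the \<open>N\<^sub>l\<close> depend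
  continuously on the step size and tend to \<open>n\<^sub>l\<close>; norms that are positive at the start stay positive for
  a short time.

  In the spread case, some \<open>N\<^sub>l\<close> below and some above \<open>M\<close> is then nonzero. With \<open>\<lambda> = exp s\<close>, the algebraic
  equation says that an exponential sum in \<open>s\<close> vanishes, whose terms are all nondecreasing, one of them
  tending to \<open>\<infinity>\<close> and one to \<open>-\<infinity>\<close> at the two ends; so there is exactly one root
  (\<open>exp_sum_unique_zero\<close>). The three product relations say that a positive \<open>\<sigma>\<close> is a geometric
  progression, and for \<open>\<sigma>\<^sub>l\<^sup>2 = \<sigma>\<^sub>0\<^sup>2 \<lambda>\<^sup>l\<close> the two moment conditions fix \<open>\<sigma>\<^sub>0\<close> and reduce to the algebraic
  equation (\<open>moments_iff_lambda_equation\<close>).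

  In the concentrated case continuity alone does not suffice: components that vanish initially could
  become nonzero, all on the same side of \<open>M\<close>. They do not, by symmetry. The flow commutes with the
  phase rotations \<open>\<phi>\<^sub>l \<mapsto> a z\<^sup>l \<phi>\<^sub>l\<close>, and the rotation with \<open>a z\<^sup>m = 1\<close> fixes the initial state. By uniqueness
  it fixes the solution, so the other components stay zero (\<open>single_component_preserved\<close>), and one is
  in case (i) or (ii).
\<close>

section \<open>The exponential sum\<close>

text \<open>
  Each term is nondecreasing in \<open>s\<close>, whatever the sign of its exponent, and the terms \<open>i\<close> and \<open>j\<close> are
  strictly increasing. So any increment of the sum dominates that of one chosen term, and
  \<open>exp x \<ge> 1 + x\<close> bounds the latter linearly; this gives a sign change at explicit points.
\<close>

lemma exp_sum_unique_zero:
  fixes a w :: "'a \<Rightarrow> real"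
  assumes fin: "finite S" and w: "\<And>l. l \<in> S \<Longrightarrow> 0 \<le> w l"
    and i: "i \<in> S" "a i < 0" "0 < w i" and j: "j \<in> S" "0 < a j" "0 < w j"
  shows "\<exists>!s. (\<Sum>l\<in>S. a l * w l * exp (a l * s)) = 0"
proof -
  define h where "h s = (\<Sum>l\<in>S. a l * w l * exp (a l * s))" for s
  have mono1: "a l * w l * exp (a l * s) \<le> a l * w l * exp (a l * t)" if "l \<in> S" "s \<le> t" for l s t
  proof (cases "0 \<le> a l")
    case True
    then show ?thesis using that w[of l] by (intro mult_left_mono) (auto intro: mult_left_mono)
  next
    case False
    then have "exp (a l * t) \<le> exp (a l * s)" using that by (simp add: mult_left_mono_neg)
    moreover have "a l * w l \<le> 0" using False w[OF that(1)] by (simp add: mult_nonpos_nonneg)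
    ultimately show ?thesis by (rule mult_left_mono_neg)
  qed
  have one: "h t - h s \<ge> a k * w k * exp (a k * t) - a k * w k * exp (a k * s)"
    if "k \<in> S" "s \<le> t" for k s t
  proof -
    have "h t - h s = (\<Sum>l\<in>S. a l * w l * exp (a l * t) - a l * w l * exp (a l * s))"
      by (simp add: h_def sum_subtractf)
    also have "\<dots> \<ge> a k * w k * exp (a k * t) - a k * w k * exp (a k * s)"
      using that mono1 fin by (intro member_le_sum) (auto)
    finally show ?thesis .
  qed
  have less: "h s < h t" if "s < t" for s t
  proof -
    have "a j * w j * exp (a j * s) < a j * w j * exp (a j * t)" using j that by simp
    then show ?thesis using one[OF j(1), of s t] that by simp
  qed
  have up: "\<exists>s\<ge>0. 0 \<le> h s"
  proof -
    \<comment> \<open>The term \<open>j\<close> grows at least with its slope \<open>a j * a j * w j\<close> at \<open>0\<close>; this \<open>s\<close> makes up for \<open>h 0\<close>.\<close>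
    define s where "s = \<bar>h 0\<bar> / (a j * a j * w j)"
    have s: "0 \<le> s" "s * (a j * a j * w j) = \<bar>h 0\<bar>" using j by (auto simp: s_def)
    have "a j * w j * (a j * s) \<le> a j * w j * (exp (a j * s) - 1)"
    proof (rule mult_left_mono)
      show "a j * s \<le> exp (a j * s) - 1" using exp_ge_add_one_self[of "a j * s"] by linarith
    qed (use j in simp)
    then have "\<bar>h 0\<bar> \<le> a j * w j * exp (a j * s) - a j * w j"
      using s(2) by (simp add: algebra_simps)
    then have "0 \<le> h s" using one[OF j(1) s(1)] by simp
    then show ?thesis using s by blast
  qed
  have down: "\<exists>s\<le>0. h s \<le> 0"
  proof -
    define s where "s = - \<bar>h 0\<bar> / (a i * a i * w i)"
    have s: "s \<le> 0" "s * (a i * a i * w i) = - \<bar>h 0\<bar>" using i by (auto simp: s_def)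
    have "a i * w i * (exp (a i * s) - 1) \<le> a i * w i * (a i * s)"
    proof (rule mult_left_mono_neg)
      show "a i * s \<le> exp (a i * s) - 1" using exp_ge_add_one_self[of "a i * s"] by linarith
    qed (use i in \<open>simp add: mult_nonpos_nonneg\<close>)
    then have "a i * w i * exp (a i * s) - a i * w i \<le> - \<bar>h 0\<bar>"
      using s(2) by (simp add: algebra_simps)
    then have "h s \<le> 0" using one[OF i(1) s(1)] by simp
    then show ?thesis using s by blast
  qed
  obtain s1 where s1: "s1 \<le> 0" "h s1 \<le> 0" using down by blast
  obtain s2 where s2: "0 \<le> s2" "0 \<le> h s2" using up by blast
  have "continuous_on {s1..s2} h" unfolding h_def by (intro continuous_intros)
  then obtain s where s: "h s = 0" using IVT'[of h s1 0 s2] s1 s2 by auto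
  show ?thesis unfolding h_def[symmetric]
    using s less by (metis linorder_less_linear less_irrefl)
qed

lemma powi_eq_powr: "0 < x \<Longrightarrow> x powi k = x powr real_of_int k" for x :: real
  by (simp add: powr_real_of_int')

text \<open>
  Dividing the equation by \<open>\<lambda>\<^bsup>2 + M\<^esup>\<close> makes the exponent of each term equal to its coefficient \<open>l - M\<close>,
  which is what makes all terms monotone in the same direction.
\<close>

lemma lambda_equation_exp:
  "lambda_equation M N (exp s) \<longleftrightarrow>
     (\<Sum>l\<in>{-2..2}. (real_of_int l - M) * (N l)\<^sup>2 * exp ((real_of_int l - M) * s)) = 0"
proof -
  have "(real_of_int l - M) * (N l)\<^sup>2 * exp s powi (l + 2)
      = exp ((2 + M) * s) * ((real_of_int l - M) * (N l)\<^sup>2 * exp ((real_of_int l - M) * s))" for l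
  proof -
    have "exp s powi (l + 2) = exp ((2 + M) * s + (real_of_int l - M) * s)"
      by (simp add: powi_eq_powr powr_def algebra_simps)
    then show ?thesis by (simp add: exp_add)
  qed
  then have "(\<Sum>l\<in>{-2..2}. (real_of_int l - M) * (N l)\<^sup>2 * exp s powi (l + 2))
     = exp ((2 + M) * s) *
       (\<Sum>l\<in>{-2..2}. (real_of_int l - M) * (N l)\<^sup>2 * exp ((real_of_int l - M) * s))"
    unfolding sum_distrib_left by (intro sum.cong) auto
  then show ?thesis by (simp add: lambda_equation_def)
qed

lemma lambda_equation_powi:
  assumes "0 < lam"
  shows "lambda_equation M N lam \<longleftrightarrow>
    (\<Sum>l\<in>{-2..2}. (real_of_int l - M) * (N l)\<^sup>2 * lam powi l) = 0"
proof -
  have "(\<Sum>l\<in>{-2..2}. (real_of_int l - M) * (N l)\<^sup>2 * lam powi (l + 2))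
    = lam\<^sup>2 * (\<Sum>l\<in>{-2..2}. (real_of_int l - M) * (N l)\<^sup>2 * lam powi l)"
    using assms by (simp add: sum_distrib_left power_int_add mult_ac)
  then show ?thesis using assms by (simp add: lambda_equation_def)
qed

lemma lambda_equation_unique_root:
  assumes "i \<in> {-2..2}" "real_of_int i < M" "N i \<noteq> 0"
    and "j \<in> {-2..2}" "M < real_of_int j" "N j \<noteq> 0"
  shows "\<exists>lam>0. lambda_equation M N lam \<and> (\<forall>\<mu>. \<mu> > 0 \<and> lambda_equation M N \<mu> \<longrightarrow> \<mu> = lam)"
proof -
  have "\<exists>!s. (\<Sum>l\<in>{-2..2}. (real_of_int l - M) * (N l)\<^sup>2 * exp ((real_of_int l - M) * s)) = 0"
    using assms by (intro exp_sum_unique_zero[where i = i and j = j]) auto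
  then obtain s where s: "lambda_equation M N (exp s)"
    and uniq: "\<And>t. lambda_equation M N (exp t) \<Longrightarrow> t = s"
    unfolding lambda_equation_exp by auto
  have "\<mu> = exp s" if "\<mu> > 0" "lambda_equation M N \<mu>" for \<mu>
    using uniq[of "ln \<mu>"] that by force
  with s show ?thesis by (intro exI[of _ "exp s"]) auto
qed

section \<open>The projection constants\<close>

lemma index_set: "{-2..2} = {-2, -1, 0, 1, 2 :: int}"
  by auto

lemma formula_i_projection:
  assumes "case_i M N" "formula_i N \<sigma>"
  shows "projection_system M N \<sigma>"
proof -
  have N: "0 < N 1" "N 2 = 0" "N 0 = 0" "N (-1) = 0" "N (-2) = 0" "M = 1"
    using assms(1) by (auto simp: case_i_def)
  have \<sigma>: "\<sigma> 1 = 1 / N 1" "\<sigma> 0 = 1" "\<sigma> 2 = (1 / N 1)\<^sup>2" "\<sigma> (-1) = N 1" "\<sigma> (-2) = (N 1)\<^sup>2"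
    using assms(2) by (auto simp: formula_i_def power_int_minus power_divide)
  show ?thesis
    using N(1) by (auto simp: projection_system_def index_set N(2-) \<sigma> power_divide)
qed

lemma formula_ii_projection:
  assumes "case_ii M N" "formula_ii N \<sigma>"
  shows "projection_system M N \<sigma>"
proof -
  have N: "0 < N 0" "N 2 = 0" "N 1 = 0" "N (-1) = 0" "N (-2) = 0" "M = 0"
    using assms(1) by (auto simp: case_ii_def)
  have \<sigma>: "\<sigma> 0 = 1 / N 0" "\<sigma> 1 = 1" "\<sigma> 2 = N 0" "\<sigma> (-1) = (1 / N 0)\<^sup>2" "\<sigma> (-2) = (1 / N 0) ^ 3"
    using assms(2) by (auto simp: formula_ii_def power_int_minus power_divide)
  show ?thesis
    using N(1)
    by (auto simp: projection_system_def index_set N(2-) \<sigma> power_divide power2_eq_square power3_eq_cube)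
qed

text \<open>
  The defect of the magnetization, namely the second moment sum minus \<open>M\<close> times the first one, equals
  \<open>c\<^sup>2\<close> times the left side of the algebraic equation divided by \<open>\<lambda>\<^sup>2\<close>.
\<close>

lemma moments_iff_lambda_equation:
  assumes lam: "0 < lam" and c: "0 < c"
    and sq: "\<And>l. l \<in> {-2..2} \<Longrightarrow> (\<sigma> l)\<^sup>2 = c\<^sup>2 * lam powi l"
  shows "(\<Sum>l\<in>{-2..2}. (\<sigma> l)\<^sup>2 * (N l)\<^sup>2) = 1 \<and>
         (\<Sum>l\<in>{-2..2}. real_of_int l * (\<sigma> l)\<^sup>2 * (N l)\<^sup>2) = M \<longleftrightarrow>
      c\<^sup>2 * (\<Sum>l\<in>{-2..2}. lam powi l * (N l)\<^sup>2) = 1 \<and> lambda_equation M N lam"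
proof -
  have mass: "(\<Sum>l\<in>{-2..2}. (\<sigma> l)\<^sup>2 * (N l)\<^sup>2) = c\<^sup>2 * (\<Sum>l\<in>{-2..2}. lam powi l * (N l)\<^sup>2)"
    unfolding sum_distrib_left by (intro sum.cong) (simp_all add: sq)
  have "(\<Sum>l\<in>{-2..2}. real_of_int l * (\<sigma> l)\<^sup>2 * (N l)\<^sup>2) - M * (\<Sum>l\<in>{-2..2}. (\<sigma> l)\<^sup>2 * (N l)\<^sup>2)
     = (\<Sum>l\<in>{-2..2}. c\<^sup>2 * ((real_of_int l - M) * (N l)\<^sup>2 * lam powi l))"
    unfolding sum_distrib_left sum_subtractf[symmetric]
    by (intro sum.cong) (auto simp: sq algebra_simps)
  then have "(\<Sum>l\<in>{-2..2}. real_of_int l * (\<sigma> l)\<^sup>2 * (N l)\<^sup>2)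
       = M * (\<Sum>l\<in>{-2..2}. (\<sigma> l)\<^sup>2 * (N l)\<^sup>2) \<longleftrightarrow> lambda_equation M N lam"
    using c unfolding lambda_equation_powi[OF lam] sum_distrib_left[symmetric] by auto
  with mass show ?thesis by auto
qed

text \<open>
  Some nonzero \<open>N k\<close> is required: otherwise the sum under the square root vanishes and the formula
  degenerates to \<open>\<sigma> 0 = 0\<close>.
\<close>

lemma formula_iii_projection:
  assumes lam: "0 < lam" "lambda_equation M N lam" and k: "k \<in> {-2..2}" "N k \<noteq> 0"
    and f: "formula_iii N lam \<sigma>"
  shows "projection_system M N \<sigma>"
proof -
  define S where "S = (\<Sum>l\<in>{-2..2}. lam powi l * (N l)\<^sup>2)"
  have "lam powi k * (N k)\<^sup>2 \<le> S" unfolding S_def using lam k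
    by (intro member_le_sum) auto
  then have S: "0 < S" using lam k by (smt (verit) zero_less_power_int mult_pos_pos zero_less_power2)
  define c where "c = \<sigma> 0"
  have c: "c = 1 / sqrt S" using f by (simp add: formula_iii_def S_def c_def)
  have s: "\<sigma> l = c * lam powr (real_of_int l / 2)" if "l \<in> {-2..2}" for l
    using f lam that unfolding formula_iii_def index_set c_def by auto
  have pos: "0 < c" using c S by simp
  have sq: "(\<sigma> l)\<^sup>2 = c\<^sup>2 * lam powi l" if "l \<in> {-2..2}" for l
    using lam s[OF that] by (simp add: power_mult_distrib powr_power powi_eq_powr)
  have prod: "\<sigma> p * \<sigma> q = \<sigma> u * \<sigma> v"
    if "p \<in> {-2..2}" "q \<in> {-2..2}" "u \<in> {-2..2}" "v \<in> {-2..2}" "p + q = u + v" for p q u v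
  proof -
    have "lam powr (real_of_int p / 2) * lam powr (real_of_int q / 2)
        = lam powr (real_of_int u / 2) * lam powr (real_of_int v / 2)"
      using that(5) by (simp flip: powr_add add_divide_distrib of_int_add)
    then show ?thesis using s that by (simp add: mult_ac)
  qed
  have "c\<^sup>2 * S = 1" using S by (simp add: c power_divide)
  moreover have "\<sigma> l \<ge> 0" if "l \<in> {-2..2}" for l using s[OF that] pos by simp
  ultimately show ?thesis
    using moments_iff_lambda_equation[OF lam(1) pos sq] lam(2) prod[of 2 "-2" 0 0]
      prod[of 1 "-1" 0 0] prod[of 2 0 1 1]
    by (auto simp: projection_system_def S_def power2_eq_square)
qed

text \<open>
  The product relations leave two degrees of freedom, the middle value and the ratio \<open>r\<close> of a geometric
  progression; then \<open>r\<^sup>2\<close> solves the algebraic equation.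
\<close>

lemma positive_projection_formula_iii:
  assumes p: "projection_system M N \<sigma>" and pos: "\<And>l. l \<in> {-2..2} \<Longrightarrow> \<sigma> l > 0"
    and uniq: "\<And>\<mu>. \<mu> > 0 \<Longrightarrow> lambda_equation M N \<mu> \<Longrightarrow> \<mu> = lam"
  shows "formula_iii N lam \<sigma>"
proof -
  define c where "c = \<sigma> 0"
  define r where "r = \<sigma> 1 / c"
  have pos': "\<sigma> 2 > 0" "\<sigma> 1 > 0" "c > 0" "\<sigma> (-1) > 0" "\<sigma> (-2) > 0" using pos by (auto simp: c_def)
  then have r: "0 < r" by (simp add: r_def)
  have e1: "\<sigma> 1 = c * r" using pos' by (simp add: r_def)
  have e2: "\<sigma> 2 = c * r\<^sup>2"
    using p pos' unfolding projection_system_def r_def c_def[symmetric] by (simp add: power2_eq_square field_simps)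
  have e3: "\<sigma> (-1) = c / r"
    using p pos' unfolding projection_system_def r_def c_def[symmetric] by (simp add: power2_eq_square field_simps)
  have "c * r\<^sup>2 * \<sigma> (-2) = c\<^sup>2" using p e2 unfolding projection_system_def c_def[symmetric] by simp
  then have e4: "\<sigma> (-2) = c / r\<^sup>2"
    using pos' r by (simp add: power2_eq_square field_simps)
  have geo: "\<sigma> l = c * r powi l" if "l \<in> {-2..2}" for l
    using that e1 e2 e3 e4 c_def[symmetric] unfolding index_set
    by (auto simp: power_int_minus field_simps)
  have sq: "(\<sigma> l)\<^sup>2 = c\<^sup>2 * (r\<^sup>2) powi l" if "l \<in> {-2..2}" for l
    unfolding geo[OF that] by (simp add: power2_eq_square power_int_mult_distrib mult_ac)
  have *: "c\<^sup>2 * (\<Sum>l\<in>{-2..2}. (r\<^sup>2) powi l * (N l)\<^sup>2) = 1" "lambda_equation M N (r\<^sup>2)"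
    using moments_iff_lambda_equation[of "r\<^sup>2" c \<sigma> N M] p sq r pos'
    unfolding projection_system_def c_def[symmetric] by auto
  have lam: "lam = r\<^sup>2" using uniq[OF _ *(2)] r by simp
  define S where "S = (\<Sum>l\<in>{-2..2}. lam powi l * (N l)\<^sup>2)"
  have "c\<^sup>2 * S = 1" using *(1) by (simp add: S_def lam)
  then have "sqrt (c\<^sup>2 * S) = 1" by simp
  then have "c * sqrt S = 1" using pos' by (simp add: real_sqrt_mult)
  then have "c = 1 / sqrt S" by (simp add: eq_divide_eq) auto
  moreover have "lam powr (real_of_int l / 2) = r powi l" for l
  proof -
    have "lam = r powr 2" using r lam by simp
    then have "lam powr (real_of_int l / 2) = r powr (2 * (real_of_int l / 2))"
      by (simp only: powr_powr)
    then show ?thesis using r by (simp add: powi_eq_powr)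
  qed
  ultimately show ?thesis
    using geo unfolding formula_iii_def S_def c_def[symmetric] by auto
qed

lemma projection_constants:
  assumes "case_i M N \<or> case_ii M N \<or>
    (\<exists>i\<in>{-2..2}. \<exists>j\<in>{-2..2}. real_of_int i < M \<and> N i \<noteq> 0 \<and> M < real_of_int j \<and> N j \<noteq> 0)"
  shows "(case_i M N \<longrightarrow> (\<forall>\<sigma>. formula_i N \<sigma> \<longrightarrow> projection_system M N \<sigma>)) \<and>
      (case_ii M N \<longrightarrow> (\<forall>\<sigma>. formula_ii N \<sigma> \<longrightarrow> projection_system M N \<sigma>)) \<and>
      (\<not> case_i M N \<and> \<not> case_ii M N \<longrightarrow>
        (\<exists>lam. lam > 0 \<and> lambda_equation M N lam \<and>
          (\<forall>\<mu>. \<mu> > 0 \<and> lambda_equation M N \<mu> \<longrightarrow> \<mu> = lam) \<and>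
          (\<forall>\<sigma>. formula_iii N lam \<sigma> \<longrightarrow> projection_system M N \<sigma>) \<and>
          (\<forall>\<sigma>. projection_system M N \<sigma> \<and> (\<forall>l\<in>{-2..2}. \<sigma> l > 0) \<longrightarrow> formula_iii N lam \<sigma>)))"
proof (intro conjI impI)
  show "\<forall>\<sigma>. formula_i N \<sigma> \<longrightarrow> projection_system M N \<sigma>" if "case_i M N"
    using formula_i_projection[OF that] by blast
  show "\<forall>\<sigma>. formula_ii N \<sigma> \<longrightarrow> projection_system M N \<sigma>" if "case_ii M N"
    using formula_ii_projection[OF that] by blast
  assume "\<not> case_i M N \<and> \<not> case_ii M N"
  then obtain i j where i: "i \<in> {-2..2}" "real_of_int i < M" "N i \<noteq> 0"
    and j: "j \<in> {-2..2}" "M < real_of_int j" "N j \<noteq> 0"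
    using assms by blast
  obtain lam where lam: "0 < lam" "lambda_equation M N lam"
    and uniq: "\<forall>\<mu>. \<mu> > 0 \<and> lambda_equation M N \<mu> \<longrightarrow> \<mu> = lam"
    using lambda_equation_unique_root[OF i j] by blast
  have "formula_iii N lam \<sigma>"
    if "projection_system M N \<sigma>" "\<forall>l\<in>{-2..2}. \<sigma> l > 0" for \<sigma>
    using that uniq by (intro positive_projection_formula_iii[of M]) auto
  then show "\<exists>lam. lam > 0 \<and> lambda_equation M N lam \<and>
      (\<forall>\<mu>. \<mu> > 0 \<and> lambda_equation M N \<mu> \<longrightarrow> \<mu> = lam) \<and>
      (\<forall>\<sigma>. formula_iii N lam \<sigma> \<longrightarrow> projection_system M N \<sigma>) \<and>
      (\<forall>\<sigma>. projection_system M N \<sigma> \<and> (\<forall>l\<in>{-2..2}. \<sigma> l > 0) \<longrightarrow> formula_iii N lam \<sigma>)"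
    using lam uniq formula_iii_projection[OF lam i(1,3)] by blast
qed

section \<open>The norm on square integrable functions\<close>

lemma L2norm_sq: "(L2norm f)\<^sup>2 = (LINT x|lborel. (cmod (f x))\<^sup>2)"
  by (simp add: L2norm_def)

lemma L2norm_nonneg: "0 \<le> L2norm f"
  by (simp add: L2norm_def)

lemma in_L2_diff:
  assumes "in_L2 f" "in_L2 g"
  shows "in_L2 (\<lambda>x. f x - g x)"
proof -
  have [measurable]: "f \<in> borel_measurable lborel" "g \<in> borel_measurable lborel"
    using assms by (auto simp: in_L2_def)
  have "(cmod (f x - g x))\<^sup>2 \<le> 2 * (cmod (f x))\<^sup>2 + 2 * (cmod (g x))\<^sup>2" for x
  proof -
    have "(cmod (f x - g x))\<^sup>2 \<le> (cmod (f x) + cmod (g x))\<^sup>2"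
      by (intro power_mono norm_triangle_ineq4) simp
    also have "\<dots> \<le> 2 * (cmod (f x))\<^sup>2 + 2 * (cmod (g x))\<^sup>2"
      using zero_le_power2[of "cmod (f x) - cmod (g x)"] by (simp add: power2_eq_square algebra_simps)
    finally show ?thesis .
  qed
  then have bound: "AE x in lborel. norm ((cmod (f x - g x))\<^sup>2)
      \<le> norm (2 * (cmod (f x))\<^sup>2 + 2 * (cmod (g x))\<^sup>2)"
    by (intro AE_I2) simp
  have "integrable lborel (\<lambda>x. 2 * (cmod (f x))\<^sup>2 + 2 * (cmod (g x))\<^sup>2)"
    using assms unfolding in_L2_def
    by (intro Bochner_Integration.integrable_add integrable_mult_right) simp_all
  then have "integrable lborel (\<lambda>x. (cmod (f x - g x))\<^sup>2)"
    by (rule Bochner_Integration.integrable_bound[OF _ _ bound]) measurable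
  then show ?thesis by (simp add: in_L2_def)
qed

text \<open>
  The pointwise inequality \<open>(u + v)\<^sup>2 \<le> (1 + s) u\<^sup>2 + (1 + 1/s) v\<^sup>2\<close> can be integrated without any
  Cauchy-Schwarz inequality for integrals. Minkowski's inequality follows on choosing \<open>s\<close> as the
  ratio of the two norms.
\<close>

lemma L2norm_triangle_weighted:
  assumes "in_L2 f" "in_L2 g" "in_L2 h" and le: "\<And>x. cmod (f x) \<le> cmod (g x) + cmod (h x)" and s: "0 < s"
  shows "(L2norm f)\<^sup>2 \<le> (1 + s) * (L2norm g)\<^sup>2 + (1 + 1 / s) * (L2norm h)\<^sup>2"
proof -
  have "(cmod (f x))\<^sup>2 \<le> (1 + s) * (cmod (g x))\<^sup>2 + (1 + 1 / s) * (cmod (h x))\<^sup>2" for x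
  proof -
    have "(cmod (f x))\<^sup>2 \<le> (cmod (g x) + cmod (h x))\<^sup>2"
      by (intro power_mono le) simp
    also have "\<dots> \<le> (1 + s) * (cmod (g x))\<^sup>2 + (1 + 1 / s) * (cmod (h x))\<^sup>2"
    proof -
      have "(1 + s) * u\<^sup>2 + (1 + 1 / s) * v\<^sup>2 - (u + v)\<^sup>2 = (s * u - v)\<^sup>2 / s" for u v
        using s by (simp add: power2_eq_square field_simps)
      moreover have "0 \<le> (s * u - v)\<^sup>2 / s" for u v using s by simp
      ultimately show ?thesis by (metis diff_ge_0_iff_ge)
    qed
    finally show ?thesis .
  qed
  then have "(LINT x|lborel. (cmod (f x))\<^sup>2)
     \<le> (LINT x|lborel. (1 + s) * (cmod (g x))\<^sup>2 + (1 + 1 / s) * (cmod (h x))\<^sup>2)"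
    using assms unfolding in_L2_def by (intro integral_mono) auto
  also have "\<dots> = (1 + s) * (L2norm g)\<^sup>2 + (1 + 1 / s) * (L2norm h)\<^sup>2"
    using assms unfolding in_L2_def L2norm_sq by simp
  finally show ?thesis by (simp add: L2norm_sq)
qed

lemma L2norm_triangle:
  assumes "in_L2 f" "in_L2 g" "in_L2 h" and le: "\<And>x. cmod (f x) \<le> cmod (g x) + cmod (h x)"
  shows "L2norm f \<le> L2norm g + L2norm h"
proof -
  let ?A = "L2norm g" and ?B = "L2norm h"
  \<comment> \<open>The shift by \<open>e\<close> keeps the ratio \<open>?b / ?a\<close> meaningful when one of the norms vanishes.\<close>
  have "L2norm f \<le> (?A + e) + (?B + e)" if "0 < e" for e
  proof (rule power2_le_imp_le)
    let ?a = "?A + e" and ?b = "?B + e"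
    have a: "0 < ?a" and b: "0 < ?b" using that L2norm_nonneg by (metis add_nonneg_pos)+
    have "(L2norm f)\<^sup>2 \<le> (1 + ?b / ?a) * ?A\<^sup>2 + (1 + 1 / (?b / ?a)) * ?B\<^sup>2"
      using a b by (intro L2norm_triangle_weighted assms) simp
    also have "\<dots> \<le> (1 + ?b / ?a) * ?a\<^sup>2 + (1 + 1 / (?b / ?a)) * ?b\<^sup>2"
      using a b that by (intro add_mono mult_left_mono power_mono) (auto simp: L2norm_nonneg)
    also have "\<dots> = (?a + ?b)\<^sup>2"
    proof -
      have "(1 + y / x) * x\<^sup>2 + (1 + 1 / (y / x)) * y\<^sup>2 = (x + y)\<^sup>2" if "0 < x" "0 < y" for x y :: real
        using that by (simp add: power2_eq_square field_simps)
      from this[OF a b] show ?thesis .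
    qed
    finally show "(L2norm f)\<^sup>2 \<le> (?a + ?b)\<^sup>2" .
    show "0 \<le> ?a + ?b" using a b by linarith
  qed
  from this[of "e / 2" for e] have "L2norm f \<le> ?A + ?B + e" if "0 < e" for e
    using that by (force simp: add_ac)
  then show ?thesis by (rule field_le_epsilon)
qed

lemma L2norm_diff_abs:
  assumes "in_L2 f" "in_L2 g"
  shows "\<bar>L2norm f - L2norm g\<bar> \<le> L2norm (\<lambda>x. f x - g x)"
proof -
  have d: "in_L2 (\<lambda>x. f x - g x)" by (intro in_L2_diff assms)
  have "L2norm f \<le> L2norm g + L2norm (\<lambda>x. f x - g x)"
    by (intro L2norm_triangle assms d) (metis norm_triangle_sub)
  moreover have "L2norm g \<le> L2norm f + L2norm (\<lambda>x. f x - g x)"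
    by (intro L2norm_triangle assms d) (metis norm_triangle_sub norm_minus_commute)
  ultimately show ?thesis by linarith
qed

text \<open>
  The norms of the initial data determine components only almost everywhere, whereas uniqueness of the
  flow speaks about pointwise equal data. Continuity bridges the gap.
\<close>

lemma continuous_L2norm_zero:
  assumes "continuous_on UNIV f" "in_L2 f" "L2norm f = 0"
  shows "f x = 0"
proof -
  have "(LINT x|lborel. (cmod (f x))\<^sup>2) = 0" using assms(3) by (simp add: L2norm_def)
  then have "AE x in lborel. (cmod (f x))\<^sup>2 = 0"
    using assms(2) unfolding in_L2_def by (subst (asm) integral_nonneg_eq_0_iff_AE) auto
  then have "AE x in lborel. x \<in> {x. f x = 0}" by simp
  then have "x \<in> {x. f x = 0}" 
    using mem_closed_if_AE_lebesgue[of "{x. f x = 0}" x] assms(1)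
    by (simp add: closed_Collect_eq AE_completion)
  then show ?thesis by simp
qed

section \<open>Spin rotations\<close>

lemma partial_deriv_scale:
  assumes "\<And>x. f differentiable (at x)"
  shows "partial_deriv b (\<lambda>x. c * f x) = (\<lambda>x. c * partial_deriv b f x)"
proof
  fix x
  have "(f has_derivative frechet_derivative f (at x)) (at x)"
    using assms frechet_derivative_works by blast
  then have "((\<lambda>x. c * f x) has_derivative (\<lambda>h. c * frechet_derivative f (at x) h)) (at x)"
    by (rule has_derivative_mult_right)
  then show "partial_deriv b (\<lambda>x. c * f x) x = c * partial_deriv b f x"
    unfolding partial_deriv_def by (simp flip: frechet_derivative_at)
qed

lemma partial_deriv2_scale:
  assumes "twice_cont_diff f" "b \<in> Basis"
  shows "partial_deriv c (partial_deriv b (\<lambda>x. k * f x)) = (\<lambda>x. k * partial_deriv c (partial_deriv b f) x)"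
  using assms by (simp add: twice_cont_diff_def partial_deriv_scale)

lemma twice_cont_diff_scale:
  assumes "twice_cont_diff f"
  shows "twice_cont_diff (\<lambda>x. k * f x)"
proof -
  have k: "(\<lambda>x. k * g x) differentiable (at x)" if "g differentiable (at x)"
    for g :: "'a wave" and x
    using that by (intro differentiable_mult differentiable_const)
  show ?thesis
    using assms partial_deriv2_scale[OF assms, of _ _ k] unfolding twice_cont_diff_def
    by (auto simp: partial_deriv_scale intro!: k continuous_intros)
qed

lemma laplacian_scale:
  assumes "twice_cont_diff f"
  shows "laplacian (\<lambda>x. k * f x) x = k * laplacian f x"
  using partial_deriv2_scale[OF assms, of _ _ k] by (simp add: laplacian_def sum_distrib_left)

lemma flow_bracket_components:
  fixes \<phi> :: "'d::finite spinor"
  defines "c \<equiv> \<lambda>x k. \<phi> k x"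
  shows "flow_bracket V \<beta>0 \<beta>1 \<beta>2 \<phi> 2 x = H_rho V \<beta>0 \<phi> (\<phi> 2) x
      + 2 * complex_of_real \<beta>1 * complex_of_real (F_z (c x)) * \<phi> 2 x
      + complex_of_real \<beta>1 * F_minus (c x) * \<phi> 1 x
      + complex_of_real (\<beta>2 / sqrt 5) * A00 (c x) * cnj (\<phi> (-2) x)"
    and "flow_bracket V \<beta>0 \<beta>1 \<beta>2 \<phi> 1 x = H_rho V \<beta>0 \<phi> (\<phi> 1) x
      + complex_of_real \<beta>1 * complex_of_real (F_z (c x)) * \<phi> 1 x
      + complex_of_real \<beta>1 * (complex_of_real (sqrt 6 / 2) * F_minus (c x) * \<phi> 0 x + F_plus (c x) * \<phi> 2 x)
      - complex_of_real (\<beta>2 / sqrt 5) * A00 (c x) * cnj (\<phi> (-1) x)"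
    and "flow_bracket V \<beta>0 \<beta>1 \<beta>2 \<phi> 0 x = H_rho V \<beta>0 \<phi> (\<phi> 0) x
      + complex_of_real (sqrt 6 / 2) * complex_of_real \<beta>1 * (F_plus (c x) * \<phi> 1 x + F_minus (c x) * \<phi> (-1) x)
      + complex_of_real (\<beta>2 / sqrt 5) * A00 (c x) * cnj (\<phi> 0 x)"
    and "flow_bracket V \<beta>0 \<beta>1 \<beta>2 \<phi> (-1) x = H_rho V \<beta>0 \<phi> (\<phi> (-1)) x
      - complex_of_real \<beta>1 * complex_of_real (F_z (c x)) * \<phi> (-1) x
      + complex_of_real \<beta>1 * (complex_of_real (sqrt 6 / 2) * F_plus (c x) * \<phi> 0 x + F_minus (c x) * \<phi> (-2) x)
      - complex_of_real (\<beta>2 / sqrt 5) * A00 (c x) * cnj (\<phi> 1 x)"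
    and "flow_bracket V \<beta>0 \<beta>1 \<beta>2 \<phi> (-2) x = H_rho V \<beta>0 \<phi> (\<phi> (-2)) x
      - 2 * complex_of_real \<beta>1 * complex_of_real (F_z (c x)) * \<phi> (-2) x
      + complex_of_real \<beta>1 * F_plus (c x) * \<phi> (-1) x
      + complex_of_real (\<beta>2 / sqrt 5) * A00 (c x) * cnj (\<phi> 2 x)"
  by (simp_all add: flow_bracket_def Let_def c_def)

text \<open>
  A gauge rotation by \<open>a\<close> combined with a rotation of the spin about the \<open>z\<close>-axis by \<open>z\<close>. For unit \<open>a\<close>
  and \<open>z\<close> both conserve the energy of which the flow is the gradient flow.
\<close>

definition spin_phase :: "complex \<Rightarrow> complex \<Rightarrow> int \<Rightarrow> complex" where
  "spin_phase a z l = a * z powi l"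

context
  fixes a z :: complex
  assumes unit: "cmod a = 1" "cmod z = 1"
begin

lemma norm_spin_phase: "cmod (spin_phase a z l) = 1"
  using unit by (simp add: spin_phase_def norm_mult norm_power_int)

lemma unit_mult_cnj: "a * cnj a = 1" "z * cnj z = 1"
  using unit by (simp_all add: complex_norm_square[symmetric])

lemma spin_phase_values:
  "spin_phase a z 2 = a * z\<^sup>2" "spin_phase a z 1 = a * z" "spin_phase a z 0 = a"
  "spin_phase a z (-1) = a * cnj z" "spin_phase a z (-2) = a * (cnj z)\<^sup>2"
proof -
  have "inverse z = cnj z" using unit_mult_cnj(2) by (metis inverse_unique)
  then show "spin_phase a z (-1) = a * cnj z" "spin_phase a z (-2) = a * (cnj z)\<^sup>2"
    by (simp_all add: spin_phase_def power_int_minus flip: power_inverse)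
qed (simp_all add: spin_phase_def)

lemma density_spin_phase: "density (\<lambda>k. spin_phase a z k * c k) = density c"
  by (simp add: density_def norm_mult norm_spin_phase)

lemma F_z_spin_phase: "F_z (\<lambda>k. spin_phase a z k * c k) = F_z c"
  by (simp add: F_z_def norm_mult norm_spin_phase)

lemma A00_spin_phase: "A00 (\<lambda>k. spin_phase a z k * c k) = a\<^sup>2 * A00 c"
proof -
  have "2 * (a * z\<^sup>2 * c 2) * (a * (cnj z)\<^sup>2 * c (-2)) - 2 * (a * z * c 1) * (a * cnj z * c (-1)) + (a * c 0)\<^sup>2
     = a\<^sup>2 * (2 * c 2 * c (-2) - 2 * c 1 * c (-1) + (c 0)\<^sup>2)"
    using unit_mult_cnj(2) by algebra
  then show ?thesis by (simp add: A00_def spin_phase_values)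
qed

lemma F_plus_spin_phase: "F_plus (\<lambda>k. spin_phase a z k * c k) = cnj z * F_plus c"
proof -
  have "2 * (cnj a * (cnj z)\<^sup>2 * cnj (c 2) * (a * z * c 1) + cnj a * z * cnj (c (-1)) * (a * (cnj z)\<^sup>2 * c (-2)))
     + w * (cnj a * cnj z * cnj (c 1) * (a * c 0) + cnj a * cnj (c 0) * (a * cnj z * c (-1)))
    = cnj z * (2 * (cnj (c 2) * c 1 + cnj (c (-1)) * c (-2)) + w * (cnj (c 1) * c 0 + cnj (c 0) * c (-1)))" for w
    using unit_mult_cnj by algebra
  then show ?thesis by (simp add: F_plus_def spin_phase_values)
qed

lemma F_minus_spin_phase: "F_minus (\<lambda>k. spin_phase a z k * c k) = z * F_minus c"
  by (simp add: F_minus_def F_plus_spin_phase)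

text \<open>
  Every term of the bracket has the same total weight: multiplication by \<open>z\<close> (from \<open>F_minus\<close>) raises
  the index of a phase, multiplication by \<open>cnj z\<close> (from \<open>F_plus\<close>) lowers it, and \<open>a\<^sup>2\<close> (from \<open>A00\<close>)
  turns the conjugate phase of \<open>k\<close> into the phase of \<open>- k\<close>.
\<close>

lemma flow_bracket_spin_phase:
  assumes l: "l \<in> {-2..2}" and td: "twice_cont_diff (\<phi> l)"
  shows "flow_bracket V \<beta>0 \<beta>1 \<beta>2 (\<lambda>k x. spin_phase a z k * \<phi> k x) l x
    = spin_phase a z l * flow_bracket V \<beta>0 \<beta>1 \<beta>2 \<phi> l x"
proof -
  let ?p = "spin_phase a z"
  have raise: "z * ?p k = ?p (k + 1)" for k
  proof -
    have "z \<noteq> 0" using unit by auto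
    then show ?thesis by (simp add: spin_phase_def power_int_add)
  qed
  have lower: "cnj z * ?p k = ?p (k - 1)" for k
    using raise[of "k - 1"] unit_mult_cnj(2) by (metis diff_add_cancel mult.assoc mult.commute mult_1)
  have flip: "a\<^sup>2 * cnj (?p k) = ?p (- k)" for k
  proof -
    have "cnj z powi k = z powi (- k)"
      using inverse_unique[OF unit_mult_cnj(2)] by (metis power_int_inverse power_int_minus)
    moreover have "a\<^sup>2 * cnj a = a" using unit_mult_cnj(1) by (simp add: power2_eq_square mult.assoc)
    ultimately show ?thesis by (simp add: spin_phase_def flip: mult.assoc)
  qed
  have H: "H_rho V \<beta>0 (\<lambda>k x. ?p k * \<phi> k x) (\<lambda>x. ?p l * \<phi> l x) x = ?p l * H_rho V \<beta>0 \<phi> (\<phi> l) x"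
    unfolding H_rho_def laplacian_scale[OF td] density_spin_phase by (simp add: algebra_simps)
  note expand = flow_bracket_components F_z_spin_phase F_plus_spin_phase F_minus_spin_phase
    A00_spin_phase complex_cnj_mult
  consider "l = 2" | "l = 1" | "l = 0" | "l = -1" | "l = -2" using l unfolding index_set by auto
  then show ?thesis
  proof cases
    case 1
    have "z * ?p 1 = ?p 2" "a\<^sup>2 * cnj (?p (-2)) = ?p 2" using raise[of 1] flip[of "-2"] by simp_all
    with H show ?thesis unfolding 1 expand by algebra
  next
    case 2
    have "z * ?p 0 = ?p 1" "cnj z * ?p 2 = ?p 1" "a\<^sup>2 * cnj (?p (-1)) = ?p 1"
      using raise[of 0] lower[of 2] flip[of "-1"] by simp_all
    with H show ?thesis unfolding 2 expand by algebra
  next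
    case 3
    have "z * ?p (-1) = ?p 0" "cnj z * ?p 1 = ?p 0" "a\<^sup>2 * cnj (?p 0) = ?p 0"
      using raise[of "-1"] lower[of 1] flip[of 0] by simp_all
    with H show ?thesis unfolding 3 expand by algebra
  next
    case 4
    have "z * ?p (-2) = ?p (-1)" "cnj z * ?p 0 = ?p (-1)" "a\<^sup>2 * cnj (?p 1) = ?p (-1)"
      using raise[of "-2"] lower[of 0] flip[of 1] by simp_all
    with H show ?thesis unfolding 4 expand by algebra
  next
    case 5
    have "cnj z * ?p (-1) = ?p (-2)" "a\<^sup>2 * cnj (?p 2) = ?p (-2)"
      using lower[of "-1"] flip[of 2] by simp_all
    with H show ?thesis unfolding 5 expand by algebra
  qed
qed

lemma flow_solution_spin_phase:
  assumes sol: "flow_solution V \<beta>0 \<beta>1 \<beta>2 t0 t1 \<Phi>0 \<Phi>"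
    and inv: "\<And>l. l \<in> {-2..2} \<Longrightarrow> (\<lambda>x. spin_phase a z l * \<Phi>0 l x) = \<Phi>0 l"
  shows "flow_solution V \<beta>0 \<beta>1 \<beta>2 t0 t1 \<Phi>0 (\<lambda>t l x. spin_phase a z l * \<Phi> t l x)"
  unfolding flow_solution_def
proof (intro ballI conjI)
  fix l :: int assume l: "l \<in> {-2..2}"
  note S = sol[unfolded flow_solution_def, rule_format, OF l]
  show "(\<lambda>x. spin_phase a z l * \<Phi> t0 l x) = \<Phi>0 l" using S inv[OF l] by simp
  have "continuous_on ({t0..<t1} \<times> UNIV) (\<lambda>(t, x). \<Phi> t l x)" using S by blast
  then show "continuous_on ({t0..<t1} \<times> UNIV) (\<lambda>(t, x). spin_phase a z l * \<Phi> t l x)"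
    unfolding case_prod_unfold by (intro continuous_intros)
  have n: "cmod (spin_phase a z l * y) = cmod y" for y by (simp add: norm_mult norm_spin_phase)
  show "in_L2 (\<lambda>x. spin_phase a z l * \<Phi> t l x)" if "t \<in> {t0..<t1}" for t
    using S that by (auto simp: in_L2_def n intro: borel_measurable_times)
  show "continuous_on {t0..<t1} (\<lambda>t. L2norm (\<lambda>x. spin_phase a z l * \<Phi> t l x))"
    using S by (simp add: L2norm_def n)
  fix t assume t: "t \<in> {t0<..<t1}"
  then have td: "twice_cont_diff (\<Phi> t l)" using S by blast
  then show "twice_cont_diff (\<lambda>x. spin_phase a z l * \<Phi> t l x)" by (rule twice_cont_diff_scale)
  show "\<forall>x. ((\<lambda>s. spin_phase a z l * \<Phi> s l x) has_vector_derivative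
      - flow_bracket V \<beta>0 \<beta>1 \<beta>2 (\<lambda>l x. spin_phase a z l * \<Phi> t l x) l x) (at t)"
  proof
    fix x
    have "((\<lambda>s. \<Phi> s l x) has_vector_derivative - flow_bracket V \<beta>0 \<beta>1 \<beta>2 (\<Phi> t) l x) (at t)"
      using S t by blast
    then have "((\<lambda>s. spin_phase a z l * \<Phi> s l x) has_vector_derivative
        spin_phase a z l * - flow_bracket V \<beta>0 \<beta>1 \<beta>2 (\<Phi> t) l x) (at t)"
      by (rule has_vector_derivative_mult_right)
    then show "((\<lambda>s. spin_phase a z l * \<Phi> s l x) has_vector_derivative
        - flow_bracket V \<beta>0 \<beta>1 \<beta>2 (\<lambda>l x. spin_phase a z l * \<Phi> t l x) l x) (at t)"
      using flow_bracket_spin_phase[OF l, of "\<Phi> t"] td by simp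
  qed
qed

end

text \<open>
  The rotation by \<open>\<i> powi (l - m)\<close> fixes the data, hence the solution. For \<open>m \<in> {-1..1}\<close> and \<open>l \<noteq> m\<close>
  one has \<open>0 < \<bar>l - m\<bar> \<le> 3\<close>, so this phase differs from \<open>1\<close> and the component \<open>l\<close> must vanish.
\<close>

lemma single_component_preserved:
  assumes uf: "unique_flow V \<beta>0 \<beta>1 \<beta>2 t0 t1 \<Phi>0"
    and sol: "flow_solution V \<beta>0 \<beta>1 \<beta>2 t0 t1 \<Phi>0 \<Phi>"
    and m: "m \<in> {-1..1}"
    and zero: "\<And>l x. l \<in> {-2..2} \<Longrightarrow> l \<noteq> m \<Longrightarrow> \<Phi>0 l x = 0"
    and l: "l \<in> {-2..2}" "l \<noteq> m" and t: "t \<in> {t0..<t1}"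
  shows "\<Phi> t l x = 0"
proof -
  define p where "p = spin_phase (\<i> powi (- m)) \<i>"
  have p: "p k = \<i> powi (k - m)" for k
    by (simp add: p_def spin_phase_def flip: power_int_add)
  have "flow_solution V \<beta>0 \<beta>1 \<beta>2 t0 t1 \<Phi>0 (\<lambda>t l x. p l * \<Phi> t l x)"
    unfolding p_def
  proof (rule flow_solution_spin_phase[OF _ _ sol])
    show "cmod (\<i> powi - m) = 1" by (simp add: norm_power_int)
    fix k :: int assume "k \<in> {-2..2}"
    then show "(\<lambda>x. spin_phase (\<i> powi - m) \<i> k * \<Phi>0 k x) = \<Phi>0 k"
      using zero[of k] p[of k] by (cases "k = m") (auto simp: p_def)
  qed simp
  with sol have "p l * \<Phi> t l x = \<Phi> t l x"
    using uf t l unfolding unique_flow_def by metis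
  moreover have "p l \<noteq> 1"
  proof -
    have "l - m \<in> {-3..3} - {0}" using l m by auto
    then have "l - m \<in> {-3, -2, -1, 1, 2, 3}" by auto
    then show ?thesis unfolding p by (auto simp: power_int_minus power3_eq_cube complex_eq_iff)
  qed
  ultimately show ?thesis by (metis mult_cancel_right1 mult.commute mult_cancel_left1)
qed

section \<open>Small time steps\<close>

lemma flow_solution_restrict:
  assumes "flow_solution V \<beta>0 \<beta>1 \<beta>2 t0 t1 \<Phi>0 \<Phi>" "t \<le> t1"
  shows "flow_solution V \<beta>0 \<beta>1 \<beta>2 t0 t \<Phi>0 \<Phi>"
  using assms unfolding flow_solution_def
  by (auto intro: continuous_on_subset)

text \<open>
  The reference solution \<open>\<Psi>\<close> lives past time \<open>t\<close>, so its norm is continuous at \<open>t\<close>. It coincides with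
  \<open>\<Phi>\<close> before \<open>t\<close>, and convergence in \<open>L\<^sup>2\<close> implies convergence of the norms.
\<close>

lemma left_limit_L2norm:
  assumes uf: "unique_flow V \<beta>0 \<beta>1 \<beta>2 t0 t \<Phi>0"
    and ref: "flow_solution V \<beta>0 \<beta>1 \<beta>2 t0 t1 \<Phi>0 \<Psi>" and t: "t0 < t" "t < t1"
    and sol: "flow_solution V \<beta>0 \<beta>1 \<beta>2 t0 t \<Phi>0 \<Phi>" and lim: "left_limit \<Phi> t \<Phi>m"
    and l: "l \<in> {-2..2}"
  shows "L2norm (\<Phi>m l) = L2norm (\<Psi> t l)"
proof -
  have "flow_solution V \<beta>0 \<beta>1 \<beta>2 t0 t \<Phi>0 \<Psi>" using flow_solution_restrict ref t by force
  then have eq: "\<Phi> s l = \<Psi> s l" if "s \<in> {t0..<t}" for s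
    using uf sol l that unfolding unique_flow_def by (metis ext)
  have ev: "\<forall>\<^sub>F s in at_left t. s \<in> {t0..<t}"
    using eventually_at_left_real[OF t(1)] by eventually_elim auto
  have lim0: "((\<lambda>s. L2norm (\<lambda>x. \<Phi> s l x - \<Phi>m l x)) \<longlongrightarrow> 0) (at_left t)" and m: "in_L2 (\<Phi>m l)"
    using lim l unfolding left_limit_def by auto
  have "((\<lambda>s. L2norm (\<Phi> s l) - L2norm (\<Phi>m l)) \<longlongrightarrow> 0) (at_left t)"
  proof (rule Lim_null_comparison[OF _ lim0])
    show "\<forall>\<^sub>F s in at_left t. norm (L2norm (\<Phi> s l) - L2norm (\<Phi>m l)) \<le> L2norm (\<lambda>x. \<Phi> s l x - \<Phi>m l x)"
      using ev
    proof eventually_elim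
      case (elim s)
      then have "in_L2 (\<Phi> s l)" using sol l unfolding flow_solution_def by blast
      then show ?case using L2norm_diff_abs m by simp
    qed
  qed
  then have "((\<lambda>s. L2norm (\<Phi> s l)) \<longlongrightarrow> L2norm (\<Phi>m l)) (at_left t)"
    using Lim_null by blast
  moreover have "\<forall>\<^sub>F s in at_left t. L2norm (\<Phi> s l) = L2norm (\<Psi> s l)"
    using ev by eventually_elim (simp add: eq)
  ultimately have 1: "((\<lambda>s. L2norm (\<Psi> s l)) \<longlongrightarrow> L2norm (\<Phi>m l)) (at_left t)"
    using tendsto_cong by force
  have "continuous_on {t0..<t1} (\<lambda>s. L2norm (\<Psi> s l))"
    using ref l unfolding flow_solution_def by blast
  then have "isCont (\<lambda>s. L2norm (\<Psi> s l)) t"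
    using t by (intro continuous_on_interior[of "{t0..<t1}"]) auto
  then have "((\<lambda>s. L2norm (\<Psi> s l)) \<longlongrightarrow> L2norm (\<Psi> t l)) (at_left t)"
    by (simp add: isCont_def filterlim_at_split)
  with 1 show ?thesis by (meson tendsto_unique trivial_limit_at_left_real)
qed

lemma L2norm_positive_short_time:
  assumes sol: "flow_solution V \<beta>0 \<beta>1 \<beta>2 t0 (t0 + T) \<Phi>0 \<Psi>" and T: "0 < T"
    and l: "l \<in> {-2..2}" "L2norm (\<Phi>0 l) \<noteq> 0"
  shows "\<exists>\<delta>>0. \<delta> \<le> T \<and> (\<forall>\<Delta>. 0 < \<Delta> \<and> \<Delta> < \<delta> \<longrightarrow> 0 < L2norm (\<Psi> (t0 + \<Delta>) l))"
proof -
  have c: "continuous_on {t0..<t0 + T} (\<lambda>s. L2norm (\<Psi> s l))" and 0: "\<Psi> t0 l = \<Phi>0 l"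
    using sol l unfolding flow_solution_def by auto
  have pos: "0 < L2norm (\<Psi> t0 l)" using l(2) L2norm_nonneg[of "\<Phi>0 l"] by (simp add: 0 less_le)
  obtain d where d: "0 < d" "\<And>s. s \<in> {t0..<t0 + T} \<Longrightarrow> dist s t0 < d \<Longrightarrow>
      dist (L2norm (\<Psi> s l)) (L2norm (\<Psi> t0 l)) < L2norm (\<Psi> t0 l)"
    using c[unfolded continuous_on_iff, rule_format, of t0, OF _ pos] T by auto
  have "0 < L2norm (\<Psi> (t0 + \<Delta>) l)" if "0 < \<Delta>" "\<Delta> < min d T" for \<Delta>
    using d(2)[of "t0 + \<Delta>"] that by (auto simp: dist_real_def)
  then show ?thesis using d(1) T by (intro exI[of _ "min d T"]) auto
qed

text \<open>
  The sum of the signed terms \<open>(l - M) (n l)\<^sup>2\<close> vanishes; if they do not take both signs they are all zero.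
\<close>

lemma mean_dichotomy:
  fixes n :: "int \<Rightarrow> real"
  assumes fin: "finite S" and mass: "(\<Sum>l\<in>S. (n l)\<^sup>2) = 1" and mean: "(\<Sum>l\<in>S. real_of_int l * (n l)\<^sup>2) = M"
  obtains (spread) i j where "i \<in> S" "real_of_int i < M" "n i \<noteq> 0" "j \<in> S" "M < real_of_int j" "n j \<noteq> 0"
    | (single) m where "m \<in> S" "M = real_of_int m" "n m \<noteq> 0" "\<And>l. l \<in> S \<Longrightarrow> l \<noteq> m \<Longrightarrow> n l = 0"
proof -
  have bal: "(\<Sum>l\<in>S. (real_of_int l - M) * (n l)\<^sup>2) = 0"
    using mass mean by (simp add: algebra_simps sum_subtractf flip: sum_distrib_left)
  consider (a) "\<exists>i\<in>S. real_of_int i < M \<and> n i \<noteq> 0" "\<exists>j\<in>S. M < real_of_int j \<and> n j \<noteq> 0"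
    | (b) "\<forall>i\<in>S. 0 \<le> (real_of_int i - M) * (n i)\<^sup>2"
    | (c) "\<forall>i\<in>S. 0 \<le> (M - real_of_int i) * (n i)\<^sup>2"
    by (smt (verit) mult_nonneg_nonneg mult_eq_0_iff power_zero_numeral zero_le_power2)
  then have "thesis \<or> (\<forall>i\<in>S. (real_of_int i - M) * (n i)\<^sup>2 = 0)"
  proof cases
    case a
    then show ?thesis using spread by blast
  next
    case b
    then show ?thesis using bal fin by (subst (asm) sum_nonneg_eq_0_iff) auto
  next
    case c
    have "(\<Sum>l\<in>S. (M - real_of_int l) * (n l)\<^sup>2) = 0"
      using mass mean by (simp add: algebra_simps sum_subtractf flip: sum_distrib_left)
    then have "\<forall>i\<in>S. (M - real_of_int i) * (n i)\<^sup>2 = 0" using c fin by (subst (asm) sum_nonneg_eq_0_iff) auto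
    then show ?thesis by auto
  qed
  then show thesis
  proof
    assume z: "\<forall>i\<in>S. (real_of_int i - M) * (n i)\<^sup>2 = 0"
    obtain m where m: "m \<in> S" "n m \<noteq> 0" using mass by (metis (no_types, lifting) sum.neutral zero_neq_one power_zero_numeral)
    then have "M = real_of_int m" using z by force
    with m z show thesis by (intro single[of m]) auto
  qed
qed

theorem theorem3p1:
  fixes V :: "real ^ 'd::finite \<Rightarrow> real"
    and \<beta>0 \<beta>1 \<beta>2 M t0 T :: real
    and \<Phi>0 :: "'d spinor"
  assumes dim: "CARD('d) \<in> {1, 2, 3}"
    and M: "0 \<le> M" "M < 2"
    and mass: "(\<Sum>l\<in>{-2..2}. (L2norm (\<Phi>0 l))\<^sup>2) = 1"
    and magnetization: "(\<Sum>l\<in>{-2..2}. real_of_int l * (L2norm (\<Phi>0 l))\<^sup>2) = M"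
    and T: "T > 0"
    and flow: "\<And>\<Delta>. 0 < \<Delta> \<Longrightarrow> \<Delta> \<le> T \<Longrightarrow> unique_flow V \<beta>0 \<beta>1 \<beta>2 t0 (t0 + \<Delta>) \<Phi>0"
  shows "\<exists>\<delta>>0. \<forall>\<Delta>. 0 < \<Delta> \<and> \<Delta> < \<delta> \<longrightarrow>
    (\<forall>\<Phi> \<Phi>m N. flow_solution V \<beta>0 \<beta>1 \<beta>2 t0 (t0 + \<Delta>) \<Phi>0 \<Phi> \<and>
        left_limit \<Phi> (t0 + \<Delta>) \<Phi>m \<and> N = (\<lambda>l. L2norm (\<Phi>m l)) \<longrightarrow>
      (case_i M N \<longrightarrow> (\<forall>\<sigma>. formula_i N \<sigma> \<longrightarrow> projection_system M N \<sigma>)) \<and>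
      (case_ii M N \<longrightarrow> (\<forall>\<sigma>. formula_ii N \<sigma> \<longrightarrow> projection_system M N \<sigma>)) \<and>
      (\<not> case_i M N \<and> \<not> case_ii M N \<longrightarrow>
        (\<exists>lam. lam > 0 \<and> lambda_equation M N lam \<and>
          (\<forall>\<mu>. \<mu> > 0 \<and> lambda_equation M N \<mu> \<longrightarrow> \<mu> = lam) \<and>
          (\<forall>\<sigma>. formula_iii N lam \<sigma> \<longrightarrow> projection_system M N \<sigma>) \<and>
          (\<forall>\<sigma>. projection_system M N \<sigma> \<and> (\<forall>l\<in>{-2..2}. \<sigma> l > 0) \<longrightarrow> formula_iii N lam \<sigma>))))"
proof -
  obtain \<Psi> where ref: "flow_solution V \<beta>0 \<beta>1 \<beta>2 t0 (t0 + T) \<Phi>0 \<Psi>"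
    using flow[of T] T unfolding unique_flow_def by auto
  have N_eq: "L2norm (\<Phi>m l) = L2norm (\<Psi> (t0 + \<Delta>) l)"
    if "0 < \<Delta>" "\<Delta> < T" "flow_solution V \<beta>0 \<beta>1 \<beta>2 t0 (t0 + \<Delta>) \<Phi>0 \<Phi>"
      "left_limit \<Phi> (t0 + \<Delta>) \<Phi>m" "l \<in> {-2..2}" for \<Delta> \<Phi> \<Phi>m l
    using that left_limit_L2norm[OF flow[of \<Delta>] ref] by auto
  \<comment> \<open>\<open>N\<close> is described by values on \<open>{-2..2}\<close> only, since \<open>\<Psi>\<close> is determined only there.\<close>
  have "\<exists>\<delta>>0. \<delta> \<le> T \<and> (\<forall>\<Delta> N. 0 < \<Delta> \<longrightarrow> \<Delta> < \<delta> \<longrightarrow> (\<forall>l\<in>{-2..2}. N l = L2norm (\<Psi> (t0 + \<Delta>) l)) \<longrightarrow>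
      case_i M N \<or> case_ii M N \<or> (\<exists>i\<in>{-2..2}. \<exists>j\<in>{-2..2}. i < M \<and> N i \<noteq> 0 \<and> M < j \<and> N j \<noteq> 0))"
    using finite_atLeastAtMost_int mass magnetization
  proof (cases rule: mean_dichotomy)
    case (spread i j)
    obtain \<delta>i where di: "0 < \<delta>i" "\<delta>i \<le> T" "\<And>\<Delta>. 0 < \<Delta> \<Longrightarrow> \<Delta> < \<delta>i \<Longrightarrow> 0 < L2norm (\<Psi> (t0 + \<Delta>) i)"
      using L2norm_positive_short_time[OF ref T] spread by metis
    obtain \<delta>j where dj: "0 < \<delta>j" "\<delta>j \<le> T" "\<And>\<Delta>. 0 < \<Delta> \<Longrightarrow> \<Delta> < \<delta>j \<Longrightarrow> 0 < L2norm (\<Psi> (t0 + \<Delta>) j)"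
      using L2norm_positive_short_time[OF ref T] spread by metis
    have "N i \<noteq> 0 \<and> N j \<noteq> 0" if "0 < \<Delta>" "\<Delta> < min \<delta>i \<delta>j" "\<forall>l\<in>{-2..2}. N l = L2norm (\<Psi> (t0 + \<Delta>) l)"
      for \<Delta> N
      using di(3)[of \<Delta>] dj(3)[of \<Delta>] that spread(1,4) by auto
    then show ?thesis
      using di(1,2) dj(1) spread by (intro exI[of _ "min \<delta>i \<delta>j"]) force
  next
    case (single m)
    have m: "m = 0 \<or> m = 1" using M single(2) by auto
    have zero: "\<Phi>0 l x = 0" if "l \<in> {-2..2}" "l \<noteq> m" for l x
    proof (rule continuous_L2norm_zero)
      have c: "continuous_on ({t0..<t0 + T} \<times> UNIV) (\<lambda>(t, x). \<Psi> t l x)" and e: "\<Psi> t0 l = \<Phi>0 l"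
        and L: "\<forall>t\<in>{t0..<t0 + T}. in_L2 (\<Psi> t l)"
        using ref that unfolding flow_solution_def by auto
      show "in_L2 (\<Phi>0 l)" using L e T by force
      have "continuous_on UNIV (\<lambda>x. (\<lambda>(t, x). \<Psi> t l x) (t0, x))"
        using T by (intro continuous_on_compose2[OF c] continuous_intros) auto
      then show "continuous_on UNIV (\<Phi>0 l)" by (simp add: e)
      show "L2norm (\<Phi>0 l) = 0" using single(4) that by simp
    qed
    have Psi0: "L2norm (\<Psi> (t0 + \<Delta>) l) = 0" if "0 < \<Delta>" "\<Delta> < T" "l \<in> {-2..2}" "l \<noteq> m" for \<Delta> l
    proof -
      have "\<Psi> (t0 + \<Delta>) l x = 0" for x
        using single_component_preserved[OF flow[OF T order.refl] ref, of m l "t0 + \<Delta>" x] zero m that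
        by auto
      then show ?thesis by (simp add: L2norm_def)
    qed
    obtain \<delta> where d: "0 < \<delta>" "\<delta> \<le> T" "\<And>\<Delta>. 0 < \<Delta> \<Longrightarrow> \<Delta> < \<delta> \<Longrightarrow> 0 < L2norm (\<Psi> (t0 + \<Delta>) m)"
      using L2norm_positive_short_time[OF ref T] single by metis
    have "case_i M N \<or> case_ii M N"
      if "0 < \<Delta>" "\<Delta> < \<delta>" "\<forall>l\<in>{-2..2}. N l = L2norm (\<Psi> (t0 + \<Delta>) l)" for \<Delta> N
    proof -
      have "0 < N m" using that single(1) d(3) by simp
      moreover have "N l = 0" if "l \<in> {-2..2}" "l \<noteq> m" for l
        using Psi0[of \<Delta> l] that \<open>0 < \<Delta>\<close> \<open>\<Delta> < \<delta>\<close> \<open>\<forall>l\<in>_. N l = _\<close> d(2) by simp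
      ultimately show ?thesis
        using m single(2) unfolding case_i_def case_ii_def by auto
    qed
    then show ?thesis using d by blast
  qed
  then obtain \<delta> where \<delta>: "0 < \<delta>" "\<delta> \<le> T" and trichotomy:
    "\<And>\<Delta> N. \<lbrakk>0 < \<Delta>; \<Delta> < \<delta>; \<forall>l\<in>{-2..2}. N l = L2norm (\<Psi> (t0 + \<Delta>) l)\<rbrakk> \<Longrightarrow>
      case_i M N \<or> case_ii M N \<or> (\<exists>i\<in>{-2..2}. \<exists>j\<in>{-2..2}. i < M \<and> N i \<noteq> 0 \<and> M < j \<and> N j \<noteq> 0)"
    by blast
  show ?thesis
  proof (intro exI[of _ \<delta>] conjI[OF \<delta>(1)] allI impI, rule projection_constants)
    fix \<Delta> \<Phi> \<Phi>m N
    assume \<Delta>: "0 < \<Delta> \<and> \<Delta> < \<delta>" and "flow_solution V \<beta>0 \<beta>1 \<beta>2 t0 (t0 + \<Delta>) \<Phi>0 \<Phi> \<and>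
        left_limit \<Phi> (t0 + \<Delta>) \<Phi>m \<and> N = (\<lambda>l. L2norm (\<Phi>m l))"
    then have "\<forall>l\<in>{-2..2}. N l = L2norm (\<Psi> (t0 + \<Delta>) l)" using N_eq \<delta>(2) by auto
    then show "case_i M N \<or> case_ii M N \<or>
        (\<exists>i\<in>{-2..2}. \<exists>j\<in>{-2..2}. i < M \<and> N i \<noteq> 0 \<and> M < j \<and> N j \<noteq> 0)"
      using trichotomy \<Delta> by blast
  qed
qed

end
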